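(* Let $(c_i)_{i\ge 1}$ be a sequence of integers, let $F(s)=\sum_{i\ge 0} c_i\,\frac{s^{i+1}}{i+1}$ with $c_0=1$, and let $G(t)$ be the compositional inverse of $F$ (so $F(G(t))=t$). Define polynomials $B_n^G(x)$ by $$\frac{t}{G(t)}e^{xt}=\sum_{n\ge 0} B_n^G(x)\frac{t^n}{n!},$$ put $B_n^G:=B_n^G(0)$ and $\widetilde{B}_n^G(x):=B_n^G(x)-B_n^G$. Assume that $c_{p-1}\equiv 0$ or $c_{p-1}\equiv 1 \pmod p$ for every odd prime $p$, and that either $c_1\equiv c_3 \pmod 2$, or $c_1$ is odd and $c_3$ is even. Then for all integers $h>0$, $k>0$, $n\ge 0$, $$k^n\,\widetilde{B}_n^G\!\left(\frac{h}{k}\right)\in\mathbb{Z}.$$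
   Context: $G(t)$ is called the formal group exponential associated with the formal group logarithm $F(s)$; the polynomials $B_n^G(x)$ are generalized (universal) Bernoulli polynomials associated with $G$. *)

theory Defs
  imports
    "HOL-Computational_Algebra.Computational_Algebra"
    "HOL-Number_Theory.Cong"
begin

definition formal_group_log :: "(nat \<Rightarrow> int) \<Rightarrow> rat fps" where
  "formal_group_log c = Abs_fps (\<lambda>n. if n = 0 then 0 else of_int (c (n - 1)) / of_nat n)"

definition formal_group_exp :: "(nat \<Rightarrow> int) \<Rightarrow> rat fps" where
  "formal_group_exp c = fps_inv (formal_group_log c)"

text \<open>The series \<open>t / G(t) * exp (x t)\<close> as a power series in \<open>t\<close> over the ring of
  polynomials in \<open>x\<close>; \<open>fps_exp\<close> is not usable here because its argument must lie in a field.\<close>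

definition bernoulli_gen_fun :: "rat fps \<Rightarrow> rat poly fps" where
  "bernoulli_gen_fun G =
     Abs_fps (\<lambda>n. [:fps_nth (fps_X / G) n:]) * Abs_fps (\<lambda>n. monom (1 / fact n) n)"

definition bernoulli_poly :: "rat fps \<Rightarrow> nat \<Rightarrow> rat poly" where
  "bernoulli_poly G n = smult (fact n) (fps_nth (bernoulli_gen_fun G) n)"

definition bernoulli_num :: "rat fps \<Rightarrow> nat \<Rightarrow> rat" where
  "bernoulli_num G n = poly (bernoulli_poly G n) 0"

definition bernoulli_poly_tilde :: "rat fps \<Rightarrow> nat \<Rightarrow> rat poly" where
  "bernoulli_poly_tilde G n = bernoulli_poly G n - [:bernoulli_num G n:]"

lemma formal_group_log_compose_exp:
  assumes "c 0 = 1"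
  shows "formal_group_log c oo formal_group_exp c = fps_X"
  unfolding formal_group_exp_def
  by (rule fps_inv_right) (use assms in \<open>simp_all add: formal_group_log_def\<close>)

lemma bernoulli_poly_gen_fun:
  "Abs_fps (\<lambda>n. poly (bernoulli_poly G n) x / fact n) = fps_X / G * fps_exp x"
proof (rule fps_ext)
  fix n
  show "fps_nth (Abs_fps (\<lambda>n. poly (bernoulli_poly G n) x / fact n)) n
      = fps_nth (fps_X / G * fps_exp x) n"
    by (simp add: bernoulli_poly_def bernoulli_gen_fun_def fps_mult_nth poly_sum poly_monom
        fps_exp_def)
qed

lemma fps_X_div_formal_group_exp:
  assumes "c 0 = 1"
  shows "fps_X / formal_group_exp c * formal_group_exp c = fps_X"
proof -
  have "fps_nth (formal_group_exp c) 0 = 0" "fps_nth (formal_group_exp c) 1 = 1"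
    using assms by (simp_all add: formal_group_exp_def fps_inv_def formal_group_log_def)
  then have "subdegree (formal_group_exp c) = 1"
    by (intro subdegreeI) auto
  then have "formal_group_exp c dvd fps_X"
    by (subst fps_dvd_iff) auto
  then show ?thesis by simp
qed

end

theory Submission
  imports Defs "HOL-Number_Theory.Number_Theory"
begin

text \<open>
  Put \<open>\<omega> = F'\<close>, \<open>b = 1 / \<omega>\<close> and \<open>D f = b f'\<close>, all over the integers. Since \<open>G' = b \<circ> G\<close>, one has
  \<open>n! [t\<^sup>n] f(G(t)) = (D\<^sup>n f)(0)\<close>, and from \<open>t / G(t) = (F(s) / s)\<close> at \<open>s = G(t)\<close> it follows that
  \<open>B\<^sub>m = \<Sum>\<^sub>i c\<^sub>i / (i + 1) (D\<^sup>m s\<^sup>i)(0)\<close>. The series \<open>f\<close> with \<open>d | j! f\<^sub>j\<close> for all \<open>j\<close> form an ideal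
  that is stable under \<open>D\<close>; hence \<open>i!\<close> divides \<open>(D\<^sup>m s\<^sup>i)(0)\<close>, and only \<open>i + 1\<close> prime and \<open>i + 1 = 4\<close>
  contribute denominators. For \<open>i + 1 = p\<close> prime, \<open>D\<^bsup>p-1\<^esup> s\<^bsup>p-1\<^esup> \<equiv> -1 + c\<^bsub>p-1\<^esub> s\<^bsup>p-1\<^esup>\<close> modulo the ideal
  for \<open>d = p\<close>, so that for \<open>c\<^bsub>p-1\<^esub> \<equiv> 1\<close> the contribution is that of the classical von Staudt theorem.
  It is cancelled by \<open>\<Sum> (n choose m) h\<^bsup>n-m\<^esup> k\<^sup>m \<equiv> 0 (mod p)\<close>, summed over \<open>0 < m < n\<close> with \<open>p - 1 | m\<close>,
  which comes from evaluating \<open>\<Sum>\<^sub>a (h + k a)\<^sup>n\<close> over the residues \<open>a\<close> modulo \<open>p\<close>. The term \<open>i = 3\<close> is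
  treated in the same way modulo 12.
\<close>

subsection \<open>Power sums and binomial sums modulo a prime\<close>

text \<open>Since \<open>k\<close> is a unit modulo \<open>p\<close>, the affine map sending
  \<open>a\<close> to \<open>h + k * a\<close> permutes the residues.\<close>

lemma sum_power_affine_cong:
  fixes h k :: int and p :: nat
  assumes p: "prime p" and k: "\<not> int p dvd k"
  shows "[(\<Sum>a<p. (h + k * int a) ^ n) = (\<Sum>a<p. int a ^ n)] (mod int p)"
proof -
  define \<sigma> where "\<sigma> a = nat ((h + k * int a) mod int p)" for a
  have p0: "int p > 0" using p prime_gt_0_nat by simp
  have int_\<sigma>: "int (\<sigma> a) = (h + k * int a) mod int p" for a
    using p0 by (simp add: \<sigma>_def)
  have "inj_on \<sigma> {..<p}"
  proof (rule inj_onI)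
    fix a b assume ab: "a \<in> {..<p}" "b \<in> {..<p}" and "\<sigma> a = \<sigma> b"
    then have "[h + k * int a = h + k * int b] (mod int p)"
      by (metis int_\<sigma> cong_def)
    then have "[k * int a = k * int b] (mod int p)"
      by (simp add: cong_add_lcancel)
    moreover have "coprime k (int p)"
      using prime_imp_coprime [of "int p" k] p k by (simp add: coprime_commute)
    ultimately have "[int a = int b] (mod int p)"
      by (simp add: cong_mult_lcancel)
    then show "a = b"
      using ab by (simp add: cong_int_iff cong_less_modulus_unique_nat)
  qed
  moreover have "\<sigma> ` {..<p} \<subseteq> {..<p}"
    using p0 by (auto simp: \<sigma>_def nat_less_iff)
  ultimately have "bij_betw \<sigma> {..<p} {..<p}"
    by (simp add: bij_betw_def endo_inj_surj)
  then have "(\<Sum>a<p. int a ^ n) = (\<Sum>a<p. int (\<sigma> a) ^ n)"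
    by (rule sum.reindex_bij_betw [symmetric])
  moreover have "[(\<Sum>a<p. (h + k * int a) ^ n) = (\<Sum>a<p. int (\<sigma> a) ^ n)] (mod int p)"
    unfolding int_\<sigma> by (intro cong_sum cong_pow) (simp add: cong_def)
  ultimately show ?thesis by simp
qed

text \<open>If \<open>p - 1\<close> divides \<open>m\<close>, each nonzero residue contributes 1 by
  Fermat. Otherwise scaling the residues by a primitive root \<open>g\<close> only permutes them,
  yet multiplies the sum by \<open>g ^ m\<close>, which is not 1.\<close>

lemma sum_power_prime_cong:
  fixes p m :: nat
  assumes p: "prime p" and m: "m > 0"
  shows "[(\<Sum>a<p. int a ^ m) = (if (p - 1) dvd m then -1 else 0)] (mod int p)"
proof (cases "(p - 1) dvd m")
  case True
  then obtain q where q: "m = (p - 1) * q" by blast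
  have p1: "p > 1" using p by (rule prime_gt_1_nat)
  have "(\<Sum>a<p. int a ^ m) = (\<Sum>a\<in>{1..<p}. int a ^ m)"
    using m by (intro sum.mono_neutral_right) (auto simp: Suc_le_eq)
  also have "[(\<Sum>a\<in>{1..<p}. int a ^ m) = (\<Sum>a\<in>{1..<p}. 1)] (mod int p)"
  proof (rule cong_sum)
    fix a assume "a \<in> {1..<p}"
    then have "\<not> p dvd a" by (auto dest: dvd_imp_le)
    then have "[a ^ (p - 1) = 1] (mod p)"
      by (rule fermat_theorem [OF p])
    then have "[(a ^ (p - 1)) ^ q = 1 ^ q] (mod p)" by (rule cong_pow)
    then show "[int a ^ m = 1] (mod int p)"
      unfolding q power_mult by (metis cong_int_iff of_nat_1 of_nat_power power_one)
  qed
  also have "(\<Sum>a\<in>{1..<p}. 1) = int p - 1" using p1 by (simp add: of_nat_diff)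
  also have "[int p - 1 = -1] (mod int p)" by (simp add: cong_iff_dvd_diff)
  finally show ?thesis using True by simp
next
  case False
  obtain g where g: "residue_primroot p g"
    using prime_primitive_root_exists [of p] p prime_gt_1_nat by blast
  then have co: "coprime p g" and ord: "ord p g = p - 1"
    using p by (auto simp: residue_primroot_def totient_prime)
  have g_pow: "\<not> [g ^ m = 1] (mod p)"
    using False ord by (simp add: ord_divides')
  have ndvd: "\<not> int p dvd int g"
    using co p by (auto simp: prime_nat_iff coprime_absorb_left)
  let ?P = "\<Sum>a<p. int a ^ m"
  have "[int g ^ m * ?P = ?P] (mod int p)"
    using sum_power_affine_cong [OF p ndvd, of 0 m]
    by (simp add: power_mult_distrib sum_distrib_left)
  then have "int p dvd (int g ^ m - 1) * ?P"
    by (simp add: cong_iff_dvd_diff algebra_simps)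
  moreover have "\<not> int p dvd int g ^ m - 1"
    using g_pow by (metis cong_iff_dvd_diff cong_int_iff of_nat_1 of_nat_power)
  ultimately have "int p dvd ?P"
    using p by (simp add: prime_dvd_mult_iff)
  then show ?thesis using False by (simp add: cong_0_iff)
qed

lemma fermat_theorem_int:
  fixes k :: int and p :: nat
  assumes p: "prime p" and k: "\<not> int p dvd k"
  shows "[k ^ (p - 1) = 1] (mod int p)"
proof -
  define a where "a = nat (k mod int p)"
  have a: "int a = k mod int p" using prime_gt_0_nat [OF p] by (simp add: a_def)
  then have "\<not> p dvd a" using k by (simp flip: int_dvd_int_iff add: dvd_mod_iff)
  then have "[a ^ (p - 1) = 1] (mod p)" by (rule fermat_theorem [OF p])
  then have "[int a ^ (p - 1) = 1] (mod int p)"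
    by (metis cong_int_iff of_nat_1 of_nat_power)
  moreover have "[int a ^ (p - 1) = k ^ (p - 1)] (mod int p)"
    unfolding a by (intro cong_pow) (simp add: cong_def)
  ultimately show ?thesis by (meson cong_sym cong_trans)
qed

text \<open>For \<open>k\<close> a unit, expand the sum of \<open>(h + k * a) ^ n\<close> over the
  residues \<open>a\<close>: the terms \<open>m = 0\<close> and \<open>m = n\<close> already account
  for its value, so the middle terms cancel. If \<open>p\<close> divides \<open>k\<close>, each term
  has a factor \<open>k\<close> because \<open>m > 0\<close>.\<close>

lemma prime_dvd_sum_binomial_multiples:
  fixes h k :: int and p n :: nat
  assumes p: "prime p"
  shows "int p dvd (\<Sum>m\<in>{m. 0 < m \<and> m < n \<and> (p - 1) dvd m}. int (n choose m) * h ^ (n - m) * k ^ m)"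
    (is "_ dvd sum ?w ?A")
proof (cases "int p dvd k \<or> n = 0")
  case True
  then show ?thesis
    by (auto intro!: dvd_sum dvd_mult simp: dvd_power_iff dest: dvd_trans [OF _ dvd_power])
next
  case False
  then have k: "\<not> int p dvd k" and n: "n > 0" by auto
  let ?P = "\<lambda>m. \<Sum>a<p. int a ^ m"
  let ?e = "\<lambda>m. if (p - 1) dvd m then -1 else (0::int)"
  \<comment> \<open>As \<open>0 ^ 0 = 1\<close>, this sum is \<open>p\<close>; the exponent 0 falls
    outside \<open>sum_power_prime_cong\<close>.\<close>
  have P0: "[?P 0 = 0] (mod int p)" by (simp add: cong_0_iff)
  have "(\<Sum>a<p. (h + k * int a) ^ n) = (\<Sum>a<p. \<Sum>m\<le>n. ?w m * int a ^ m)"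
    by (subst add.commute, subst binomial_ring) (simp add: power_mult_distrib mult_ac)
  also have "\<dots> = (\<Sum>m\<le>n. ?w m * ?P m)"
    by (subst sum.swap) (simp add: sum_distrib_left)
  also have "\<dots> = ?w 0 * ?P 0 + (k ^ n * ?P n + (\<Sum>m\<in>{0<..<n}. ?w m * ?P m))"
  proof -
    have "{..n} = insert 0 (insert n {0<..<n})" using n by auto
    then show ?thesis using n by simp
  qed
  finally have expand: "(\<Sum>a<p. (h + k * int a) ^ n)
      = ?w 0 * ?P 0 + (k ^ n * ?P n + (\<Sum>m\<in>{0<..<n}. ?w m * ?P m))" .
  have "(\<Sum>m\<in>{0<..<n}. ?w m * ?e m) = (\<Sum>m\<in>{0<..<n}. if (p - 1) dvd m then - ?w m else 0)"
    by (rule sum.cong) simp_all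
  also have "\<dots> = (\<Sum>m\<in>{m \<in> {0<..<n}. (p - 1) dvd m}. - ?w m)"
    by (rule sum.inter_filter [symmetric]) simp
  also have "\<dots> = - sum ?w ?A"
    unfolding sum_negf by (intro arg_cong [of _ _ uminus] sum.cong) auto
  finally have "?w 0 * 0 + (k ^ n * ?e n + (\<Sum>m\<in>{0<..<n}. ?w m * ?e m))
      = k ^ n * ?e n - sum ?w ?A" by simp
  moreover have "[?w 0 * ?P 0 + (k ^ n * ?P n + (\<Sum>m\<in>{0<..<n}. ?w m * ?P m))
      = ?w 0 * 0 + (k ^ n * ?e n + (\<Sum>m\<in>{0<..<n}. ?w m * ?e m))] (mod int p)"
    using n P0
    by (intro cong_add cong_mult cong_sum cong_refl sum_power_prime_cong [OF p]) auto
  ultimately have "[(\<Sum>a<p. (h + k * int a) ^ n) = k ^ n * ?e n - sum ?w ?A] (mod int p)"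
    by (simp only: expand)
  moreover have "[(\<Sum>a<p. (h + k * int a) ^ n) = ?e n] (mod int p)"
    using sum_power_affine_cong [OF p k] sum_power_prime_cong [OF p n] by (rule cong_trans)
  ultimately have *: "[k ^ n * ?e n - sum ?w ?A = ?e n] (mod int p)"
    by (meson cong_sym cong_trans)
  \<comment> \<open>So the term \<open>m = n\<close> agrees with the left-hand side and both drop
    out.\<close>
  have "[k ^ n * ?e n = ?e n] (mod int p)"
  proof (cases "(p - 1) dvd n")
    case True
    then obtain q where q: "n = (p - 1) * q" by blast
    have "[k ^ (p - 1) = 1] (mod int p)"
      by (rule fermat_theorem_int [OF p k])
    then have "[(k ^ (p - 1)) ^ q = 1 ^ q] (mod int p)" by (rule cong_pow)
    then have "[k ^ n * (-1) = 1 * (-1)] (mod int p)"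
      unfolding q power_mult power_one by (rule cong_scalar_right)
    then show ?thesis using True by simp
  qed simp
  with * show ?thesis
    by (smt (verit) cong_iff_dvd_diff dvd_diff)
qed

text \<open>If \<open>n = a * b\<close> with \<open>a\<close> and \<open>b\<close> distinct, both
  occur as factors of the factorial. If \<open>n = a * a\<close> with \<open>a > 2\<close>, the
  factors \<open>a\<close> and \<open>2 * a\<close> do; only 4 escapes.\<close>

lemma composite_dvd_fact_pred:
  fixes n :: nat
  assumes "\<not> prime n" "n \<noteq> 4" "n > 0"
  shows "n dvd fact (n - 1)"
proof (cases "n = 1")
  case False
  with assms obtain a b where ab: "n = a * b" "1 < a" "1 < b"
    by (metis dvd_def less_one linorder_neqE_nat mult_eq_0_iff nat_mult_eq_1_iff not_gr_zero
        prime_nat_iff mult.right_neutral)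
  have *: "x * y dvd fact m" if "0 < x" "x < y" "y \<le> m" for x y m :: nat
  proof -
    have "x dvd fact (y - 1)" using that by (intro dvd_fact) auto
    then have "x * y dvd fact (y - 1) * y" by simp
    also have "\<dots> = fact y" using that by (simp add: fact_reduce mult.commute)
    also have "\<dots> dvd fact m" using that by (intro fact_dvd) auto
    finally show ?thesis .
  qed
  have lt: "a < n" "b < n" using ab by auto
  consider "a < b" | "b < a" | "a = b" by linarith
  then show ?thesis
  proof cases
    case 1
    have "a * b dvd fact (n - 1)" by (rule *) (use ab lt 1 in linarith)+
    then show ?thesis using ab by simp
  next
    case 2
    have "b * a dvd fact (n - 1)" by (rule *) (use ab lt 2 in linarith)+
    then show ?thesis using ab by (simp add: mult.commute)
  next
    case 3
    then have "a > 2" using assms ab by (cases "a = 2") auto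
    then have "3 * a \<le> a * a" by simp
    then have "2 * a \<le> n - 1" unfolding ab(1) 3 [symmetric] using \<open>a > 2\<close> by linarith
    then have "a * (2 * a) dvd fact (n - 1)"
      using ab by (intro *) auto
    then show ?thesis using ab 3 by (metis dvd_mult_right mult.left_commute)
  qed
qed simp

subsection \<open>The derivation and its invariant ideals\<close>

text \<open>With \<open>f\<close> written as an exponential series, the sum of
  \<open>a_n s^n / n!\<close>, the condition is that \<open>d\<close> divides every
  \<open>a_n\<close>. Differentiation merely shifts these Hurwitz coefficients.\<close>

definition hurwitz_dvd :: "int \<Rightarrow> int fps \<Rightarrow> bool" where
  "hurwitz_dvd d f \<longleftrightarrow> (\<forall>n. d dvd fact n * fps_nth f n)"

lemma hurwitz_dvd_0 [simp]: "hurwitz_dvd d 0"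
  by (simp add: hurwitz_dvd_def)

lemma hurwitz_dvd_add: "hurwitz_dvd d f \<Longrightarrow> hurwitz_dvd d g \<Longrightarrow> hurwitz_dvd d (f + g)"
  by (simp add: hurwitz_dvd_def distrib_left)

lemma hurwitz_dvd_deriv: "hurwitz_dvd d f \<Longrightarrow> hurwitz_dvd d (fps_deriv f)"
  unfolding hurwitz_dvd_def
proof
  fix n assume "\<forall>n. d dvd fact n * fps_nth f n"
  then have "d dvd fact (Suc n) * fps_nth f (Suc n)" by blast
  then show "d dvd fact n * fps_nth (fps_deriv f) n" by (simp add: algebra_simps)
qed

text \<open>The cofactor \<open>g\<close> has ordinary integer coefficients, and
  \<open>fact i\<close> divides \<open>fact n\<close> for \<open>i <= n\<close>.\<close>

lemma hurwitz_dvd_mult_right: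
  assumes "hurwitz_dvd d f"
  shows "hurwitz_dvd d (f * g)"
  unfolding hurwitz_dvd_def fps_mult_nth sum_distrib_left
proof (intro allI dvd_sum)
  fix n i :: nat assume i: "i \<in> {0..n}"
  have "d dvd fact i * fps_nth f i"
    using assms by (simp add: hurwitz_dvd_def)
  also have "\<dots> dvd fact n * fps_nth f i"
    using i by (intro mult_dvd_mono fact_dvd) auto
  finally show "d dvd fact n * (fps_nth f i * fps_nth g (n - i))"
    by (metis dvd_mult2 mult.assoc)
qed

lemma hurwitz_dvd_mult_left: "hurwitz_dvd d f \<Longrightarrow> hurwitz_dvd d (g * f)"
  by (simp add: hurwitz_dvd_mult_right mult.commute)

text \<open>The source of the factor \<open>fact i\<close> in all moments of
  \<open>fps_X ^ i\<close>.\<close>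

lemma hurwitz_dvd_X_power: "hurwitz_dvd (fact i) (fps_X ^ i)"
  by (simp add: hurwitz_dvd_def)

text \<open>From index \<open>p\<close> on the factorial itself supplies \<open>p\<close>, so
  calculating modulo this ideal means calculating modulo \<open>p\<close> and
  \<open>fps_X ^ p\<close>.\<close>

lemma hurwitz_dvd_primeI:
  fixes p :: nat
  assumes "prime p" "\<And>i. i < p \<Longrightarrow> int p dvd fps_nth f i"
  shows "hurwitz_dvd (int p) f"
  unfolding hurwitz_dvd_def
proof
  fix n
  show "int p dvd fact n * fps_nth f n"
  proof (cases "n < p")
    case False
    then have "p dvd fact n" using prime_gt_0_nat [OF assms(1)] by (intro dvd_fact) auto
    then have "int p dvd fact n" by (metis of_nat_dvd_iff of_nat_fact)
    then show ?thesis by simp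
  qed (use assms in auto)
qed

section \<open>The derivation and its iterates at zero\<close>

definition weighted_deriv :: "int fps \<Rightarrow> int fps \<Rightarrow> int fps" where
  "weighted_deriv b f = fps_deriv f * b"

text \<open>For \<open>b = 1 / F'\<close> this is \<open>n!\<close> times the coefficient of
  \<open>t^n\<close> in \<open>f(G(t))\<close>, see
  \<open>fact_mult_compose_formal_group_exp_nth\<close>.\<close>

definition weighted_moment :: "int fps \<Rightarrow> nat \<Rightarrow> int fps \<Rightarrow> int" where
  "weighted_moment b n f = fps_nth ((weighted_deriv b ^^ n) f) 0"

lemma weighted_moment_0 [simp]: "weighted_moment b 0 f = fps_nth f 0"
  by (simp add: weighted_moment_def)

lemma weighted_moment_Suc:
  "weighted_moment b (Suc n) f = weighted_moment b n (weighted_deriv b f)"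
  by (simp add: weighted_moment_def funpow_swap1)

lemma weighted_moment_add_index:
  "weighted_moment b (m + n) f = weighted_moment b m ((weighted_deriv b ^^ n) f)"
  by (simp add: weighted_moment_def funpow_add)

lemma weighted_moment_add:
  "weighted_moment b n (f + g) = weighted_moment b n f + weighted_moment b n g"
  by (induction n arbitrary: f g)
     (simp_all add: weighted_moment_Suc weighted_deriv_def distrib_right)

lemma weighted_moment_const_mult:
  "weighted_moment b n (fps_const a * f) = a * weighted_moment b n f"
  by (induction n arbitrary: f) (simp_all add: weighted_moment_Suc weighted_deriv_def mult.assoc)

lemma weighted_moment_const: "n > 0 \<Longrightarrow> weighted_moment b n (fps_const a) = 0"
proof (cases n)
  case (Suc m)
  have "weighted_moment b m 0 = 0" for m
    using weighted_moment_const_mult [of b m 0 0] by simp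
  then show ?thesis by (simp add: Suc weighted_moment_Suc weighted_deriv_def)
qed simp

lemma hurwitz_dvd_weighted_deriv: "hurwitz_dvd d f \<Longrightarrow> hurwitz_dvd d (weighted_deriv b f)"
  by (simp add: weighted_deriv_def hurwitz_dvd_mult_right hurwitz_dvd_deriv)

text \<open>The ideal is stable under \<open>weighted_deriv b\<close>, and \<open>0! = 1\<close>
  makes the constant terms of its members divisible by \<open>d\<close>.\<close>

lemma dvd_weighted_moment: "hurwitz_dvd d f \<Longrightarrow> d dvd weighted_moment b n f"
proof (induction n arbitrary: f)
  case 0
  then have "d dvd fact 0 * fps_nth f 0" unfolding hurwitz_dvd_def by blast
  then show ?case by simp
qed (simp add: weighted_moment_Suc hurwitz_dvd_weighted_deriv)

section \<open>Congruence modulo the ideal\<close>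

definition hurwitz_cong :: "int \<Rightarrow> int fps \<Rightarrow> int fps \<Rightarrow> bool" where
  "hurwitz_cong d f g \<longleftrightarrow> hurwitz_dvd d (f - g)"

lemma hurwitz_cong_refl [simp]: "hurwitz_cong d f f"
  by (simp add: hurwitz_cong_def)

lemma hurwitz_cong_trans [trans]:
  "hurwitz_cong d f g \<Longrightarrow> hurwitz_cong d g h \<Longrightarrow> hurwitz_cong d f h"
  unfolding hurwitz_cong_def using hurwitz_dvd_add [of d "f - g" "g - h"] by simp

lemma hurwitz_cong_mult_left: "hurwitz_cong d f g \<Longrightarrow> hurwitz_cong d (h * f) (h * g)"
  unfolding hurwitz_cong_def right_diff_distrib [symmetric] by (rule hurwitz_dvd_mult_left)

lemma hurwitz_cong_mult_right: "hurwitz_cong d f g \<Longrightarrow> hurwitz_cong d (f * h) (g * h)"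
  using hurwitz_cong_mult_left [of d f g h] by (simp add: mult.commute)

lemma hurwitz_cong_weighted_deriv:
  "hurwitz_cong d f g \<Longrightarrow> hurwitz_cong d (weighted_deriv b f) (weighted_deriv b g)"
  unfolding hurwitz_cong_def
  using hurwitz_dvd_weighted_deriv [of d "f - g" b]
  by (simp add: weighted_deriv_def left_diff_distrib)

lemma hurwitz_cong_funpow_weighted_deriv:
  "hurwitz_cong d f g \<Longrightarrow> hurwitz_cong d ((weighted_deriv b ^^ n) f) ((weighted_deriv b ^^ n) g)"
  by (induction n) (simp_all add: hurwitz_cong_weighted_deriv)

lemma weighted_moment_cong:
  assumes "hurwitz_cong d f g"
  shows "[weighted_moment b n f = weighted_moment b n g] (mod d)"
proof -
  have "d dvd weighted_moment b n (f - g)"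
    using assms by (simp add: hurwitz_cong_def dvd_weighted_moment)
  moreover have "weighted_moment b n f = weighted_moment b n (f - g) + weighted_moment b n g"
    by (simp flip: weighted_moment_add)
  ultimately show ?thesis by (simp add: cong_iff_dvd_diff)
qed

lemma hurwitz_cong_primeI:
  fixes p :: nat
  assumes "prime p" "\<And>i. i < p \<Longrightarrow> [fps_nth f i = fps_nth g i] (mod int p)"
  shows "hurwitz_cong (int p) f g"
  unfolding hurwitz_cong_def using assms
  by (intro hurwitz_dvd_primeI) (simp_all add: cong_iff_dvd_diff)

text \<open>Each derivation lowers the order of vanishing at 0 by at most one. The cofactor
  \<open>f\<close> is there for the induction.\<close>

lemma weighted_moment_X_power_eq_0: "n < i \<Longrightarrow> weighted_moment b n (fps_X ^ i * f) = 0"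
proof (induction n arbitrary: i f)
  case 0
  then show ?case by (simp add: fps_X_power_mult_nth)
next
  case (Suc n)
  then obtain j where j: "i = Suc j" "n < j" by (cases i) auto
  have "weighted_deriv b (fps_X ^ i * f)
      = fps_X ^ j * ((of_nat i * f + fps_X * fps_deriv f) * b)"
    unfolding weighted_deriv_def j fps_deriv_mult fps_deriv_power' by (simp add: algebra_simps)
  then show ?case using Suc.IH [OF j(2)] by (simp add: weighted_moment_Suc)
qed

lemma hurwitz_cong_const:
  "[a = a'] (mod d) \<Longrightarrow> hurwitz_cong d (fps_const a * f) (fps_const a' * f)"
  unfolding hurwitz_cong_def hurwitz_dvd_def
  by (simp add: cong_iff_dvd_diff flip: right_diff_distrib left_diff_distrib)

section \<open>Iterated derivation modulo a prime\<close>

lemma weighted_deriv_const_mult: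
  "weighted_deriv b (fps_const a * f) = fps_const a * weighted_deriv b f"
  by (simp add: weighted_deriv_def mult.assoc)

lemma funpow_weighted_deriv_const_mult:
  "(weighted_deriv b ^^ n) (fps_const a * f) = fps_const a * (weighted_deriv b ^^ n) f"
  by (induction n) (simp_all add: weighted_deriv_const_mult)

text \<open>Rationally \<open>D F = 1\<close>, so \<open>p - 1\<close> derivations take
  \<open>F^(p-1)\<close> to \<open>(p-1)!\<close>. An integral multiple of a truncation of
  \<open>F\<close> imitates this; the cut-off term \<open>c_(p-1) s^p / p\<close> accounts for the
  correction by \<open>c (p - 1)\<close>.\<close>

lemma funpow_weighted_deriv_prime_cong:
  fixes c :: "nat \<Rightarrow> int" and p :: nat
  assumes b: "Abs_fps c * b = 1" and c0: "c 0 = 1" and p: "prime p"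
  shows "hurwitz_cong (int p) ((weighted_deriv b ^^ (p - 1)) (fps_X ^ (p - 1)))
           (fps_const (fact (p - 1)) * (1 - fps_const (c (p - 1)) * fps_X ^ (p - 1)))"
proof -
  define w :: int where "w = fact (p - 1)"
  define c' where "c' = c (p - 1)"
  \<comment> \<open>\<open>Y\<close> is the logarithm truncated below \<open>fps_X ^ p\<close>, scaled by \<open>w\<close> to clear denominators;
    up to a multiple of \<open>fps_X ^ (p - 1)\<close>, its derivative \<open>weighted_deriv b Y\<close> is constant.\<close>
  define q where "q = Abs_fps (\<lambda>i. if i < p - 1 then c i * (w div int (Suc i)) else 0)"
  define Y where "Y = fps_X * q"
  have p1: "p > 1" using p by (rule prime_gt_1_nat)
  have b0: "fps_nth b 0 = 1"
    using arg_cong [OF b, of "\<lambda>f. fps_nth f 0"] c0 by simp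
  have X_p: "hurwitz_dvd (int p) (fps_X ^ p * f)" for f
    by (rule hurwitz_dvd_primeI [OF p]) (simp add: fps_X_power_mult_nth)
  have X_p': "hurwitz_cong (int p) (fps_X ^ (p - 1) * f) (fps_const (fps_nth f 0) * fps_X ^ (p - 1))" for f
    by (rule hurwitz_cong_primeI [OF p]) (auto simp: fps_X_power_mult_nth)
  have w_pow: "[w ^ (p - 1) = 1] (mod int p)"
  proof (rule fermat_theorem_int [OF p])
    have "\<not> p dvd fact (p - 1)" using p p1 by (simp add: prime_dvd_fact_iff)
    then show "\<not> int p dvd w" unfolding w_def by (metis of_nat_dvd_iff of_nat_fact)
  qed
  have deriv_Y: "fps_deriv Y = fps_const w * Abs_fps (\<lambda>i. if i < p - 1 then c i else 0)"
  proof (rule fps_ext)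
    fix i
    show "fps_nth (fps_deriv Y) i
        = fps_nth (fps_const w * Abs_fps (\<lambda>i. if i < p - 1 then c i else 0)) i"
    proof (cases "i < p - 1")
      case True
      then have "Suc i dvd fact (p - 1)" by (intro dvd_fact) auto
      then have "int (Suc i) dvd w" unfolding w_def by (metis of_nat_dvd_iff of_nat_fact)
      then have "int (Suc i) * (w div int (Suc i)) = w" by (rule dvd_mult_div_cancel)
      then have "c i * (int (Suc i) * (w div int (Suc i))) = c i * w" by simp
      moreover have "fps_nth (fps_deriv Y) i = int (Suc i) * (c i * (w div int (Suc i)))"
        using True by (simp add: Y_def q_def distrib_right)
      ultimately show ?thesis using True by (simp add: algebra_simps)
    qed (simp add: Y_def q_def)
  qed
  have Y': "hurwitz_cong (int p) (weighted_deriv b Y) (fps_const w * (1 - fps_const c' * fps_X ^ (p - 1)))"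
  proof -
    have "hurwitz_cong (int p) (Abs_fps (\<lambda>i. if i < p - 1 then c i else 0))
        (Abs_fps c - fps_const c' * fps_X ^ (p - 1))"
      by (rule hurwitz_cong_primeI [OF p]) (auto simp: c'_def not_less le_less_Suc_eq)
    then have "hurwitz_cong (int p) (weighted_deriv b Y)
        (fps_const w * (Abs_fps c - fps_const c' * fps_X ^ (p - 1)) * b)"
      unfolding weighted_deriv_def deriv_Y
      by (intro hurwitz_cong_mult_right hurwitz_cong_mult_left)
    also have "fps_const w * (Abs_fps c - fps_const c' * fps_X ^ (p - 1)) * b
        = fps_const w * (1 - fps_const c' * (fps_X ^ (p - 1) * b))"
      by (simp add: algebra_simps flip: b)
    also have "hurwitz_cong (int p) \<dots> (fps_const w * (1 - fps_const c' * fps_X ^ (p - 1)))"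
    proof (rule hurwitz_cong_mult_left)
      have "hurwitz_cong (int p) (- fps_const c' * (fps_X ^ (p - 1) * b)) (- fps_const c' * fps_X ^ (p - 1))"
        using X_p' [of b] by (intro hurwitz_cong_mult_left) (simp add: b0)
      then show "hurwitz_cong (int p) (1 - fps_const c' * (fps_X ^ (p - 1) * b))
          (1 - fps_const c' * fps_X ^ (p - 1))"
        by (simp add: hurwitz_cong_def del: fps_const_neg)
    qed
    finally show ?thesis .
  qed
  \<comment> \<open>For \<open>m > 0\<close> the correction in \<open>fps_X ^ (p - 1)\<close> meets
    a factor \<open>fps_X\<close> of \<open>Y ^ m\<close> and falls into the ideal. For
    \<open>m = 0\<close> it survives, so the last derivation is carried out separately.\<close>
  have Y_step: "hurwitz_cong (int p) (weighted_deriv b (Y ^ Suc m)) (fps_const (int (Suc m) * w) * Y ^ m)"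
    if m: "m > 0" for m
  proof -
    obtain r where r: "Y ^ m = fps_X * r"
      using m by (cases m) (auto simp: Y_def mult.assoc)
    have "weighted_deriv b (Y ^ Suc m) = fps_const (int (Suc m)) * Y ^ m * weighted_deriv b Y"
      unfolding weighted_deriv_def fps_deriv_power by (simp add: mult_ac)
    also have "hurwitz_cong (int p) \<dots>
        (fps_const (int (Suc m)) * Y ^ m * (fps_const w * (1 - fps_const c' * fps_X ^ (p - 1))))"
      by (rule hurwitz_cong_mult_left [OF Y'])
    also have "hurwitz_cong (int p) \<dots> (fps_const (int (Suc m) * w) * Y ^ m)"
    proof -
      have ring: "a * (x * r) * (v * (1 - d * z)) - a * v * (x * r) = (x * z) * (- (a * v * d) * r)"
        for a x r v d z :: "int fps"
        by (simp add: algebra_simps)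
      have "fps_X ^ p = fps_X * (fps_X :: int fps) ^ (p - 1)"
        using p1 by (simp flip: power_Suc)
      then have "fps_const (int (Suc m)) * Y ^ m * (fps_const w * (1 - fps_const c' * fps_X ^ (p - 1)))
            - fps_const (int (Suc m) * w) * Y ^ m
          = fps_X ^ p * (- (fps_const (int (Suc m)) * fps_const w * fps_const c') * r)"
        unfolding r fps_const_mult [symmetric] by (simp only: ring)
      then show ?thesis unfolding hurwitz_cong_def by (simp only: X_p)
    qed
    finally show ?thesis .
  qed
  have Y_iter: "hurwitz_cong (int p) ((weighted_deriv b ^^ m) (Y ^ Suc m))
      (fps_const (fact (Suc m) * w ^ m) * Y)" for m
  proof (induction m)
    case (Suc m)
    have "(weighted_deriv b ^^ Suc m) (Y ^ Suc (Suc m))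
        = (weighted_deriv b ^^ m) (weighted_deriv b (Y ^ Suc (Suc m)))"
      by (simp only: funpow_Suc_right o_apply)
    also have "hurwitz_cong (int p) \<dots>
        ((weighted_deriv b ^^ m) (fps_const (int (Suc (Suc m)) * w) * Y ^ Suc m))"
      by (intro hurwitz_cong_funpow_weighted_deriv Y_step) simp
    also have "\<dots> = fps_const (int (Suc (Suc m)) * w) * (weighted_deriv b ^^ m) (Y ^ Suc m)"
      by (rule funpow_weighted_deriv_const_mult)
    also have "hurwitz_cong (int p) \<dots>
        (fps_const (int (Suc (Suc m)) * w) * (fps_const (fact (Suc m) * w ^ m) * Y))"
      by (rule hurwitz_cong_mult_left [OF Suc.IH])
    also have "\<dots> = fps_const (int (Suc (Suc m)) * w * (fact (Suc m) * w ^ m)) * Y"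
      by (simp only: mult.assoc flip: fps_const_mult)
    also have "int (Suc (Suc m)) * w * (fact (Suc m) * w ^ m) = fact (Suc (Suc m)) * w ^ Suc m"
      by (simp only: fact_Suc power_Suc mult_ac)
    finally show ?case .
  qed simp
  obtain r where r: "p = Suc (Suc r)" using less_imp_Suc_add [OF p1] by auto
  \<comment> \<open>Only the coefficient at \<open>p - 1\<close> matters, and there
    \<open>Y ^ (p - 1)\<close> has \<open>w ^ (p - 1)\<close>, which is 1 by Fermat.\<close>
  have X_Y: "hurwitz_cong (int p) (fps_X ^ (p - 1)) (Y ^ (p - 1))"
  proof -
    have "fps_nth q 0 = w" using p1 c0 by (simp add: q_def)
    then have "fps_nth (q ^ (p - 1)) 0 = w ^ (p - 1)" by (simp add: fps_power_zeroth)
    then have "[1 = fps_nth (q ^ (p - 1)) 0] (mod int p)"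
      using w_pow by (simp only: cong_sym_eq)
    then show ?thesis
      unfolding Y_def power_mult_distrib
      by (intro hurwitz_cong_primeI [OF p]) (auto simp: fps_X_power_mult_nth)
  qed
  have "hurwitz_cong (int p) ((weighted_deriv b ^^ (p - 1)) (fps_X ^ (p - 1)))
      ((weighted_deriv b ^^ (p - 1)) (Y ^ (p - 1)))"
    by (rule hurwitz_cong_funpow_weighted_deriv [OF X_Y])
  also have "\<dots> = weighted_deriv b ((weighted_deriv b ^^ r) (Y ^ Suc r))"
    by (simp add: r)
  also have "hurwitz_cong (int p) \<dots> (weighted_deriv b (fps_const (fact (Suc r) * w ^ r) * Y))"
    by (rule hurwitz_cong_weighted_deriv [OF Y_iter])
  \<comment> \<open>Since \<open>Suc r = p - 1\<close>, the factorial is one more factor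
    \<open>w\<close>.\<close>
  also have "\<dots> = fps_const (w ^ (p - 1)) * weighted_deriv b Y"
    by (simp add: weighted_deriv_const_mult r w_def)
  also have "hurwitz_cong (int p) \<dots> (fps_const 1 * weighted_deriv b Y)"
    by (rule hurwitz_cong_const [OF w_pow])
  also have "\<dots> = weighted_deriv b Y" by simp
  also note Y'
  finally show ?thesis by (simp only: w_def c'_def)
qed

text \<open>By Wilson, \<open>p - 1\<close> derivations take \<open>fps_X ^ (p - 1)\<close> to
  \<open>fps_X ^ (p - 1) - 1\<close> modulo the ideal. Hence the moments with \<open>m > 0\<close>
  have period \<open>p - 1\<close>; they vanish for \<open>0 < m < p - 1\<close>, and the constant
  gives the value -1 at \<open>m = p - 1\<close>.\<close>

lemma weighted_moment_X_power_prime_cong: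
  fixes c :: "nat \<Rightarrow> int" and p :: nat
  assumes b: "Abs_fps c * b = 1" and c0: "c 0 = 1" and p: "prime p"
    and cp: "[c (p - 1) = 1] (mod int p)" and m: "m > 0"
  shows "[weighted_moment b m (fps_X ^ (p - 1)) = (if (p - 1) dvd m then -1 else 0)] (mod int p)"
  using m
proof (induction m rule: less_induct)
  case (less m)
  have p1: "p > 1" using p by (rule prime_gt_1_nat)
  show ?case
  proof (cases "m < p - 1")
    case True
    then have "\<not> (p - 1) dvd m" using less.prems by (auto dest: dvd_imp_le)
    then show ?thesis
      using weighted_moment_X_power_eq_0 [OF True, of b 1] by simp
  next
    case False
    define n where "n = m - (p - 1)"
    have m_eq: "m = n + (p - 1)" and n: "n < m" using False p1 by (auto simp: n_def)
    have dvd_iff: "(p - 1) dvd m \<longleftrightarrow> (p - 1) dvd n" unfolding m_eq by simp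
    have w: "[fact (p - 1) = (-1::int)] (mod int p)"
      using wilson_theorem [OF p] by simp
    let ?M = "weighted_moment b n (fps_X ^ (p - 1))"
    have "[weighted_moment b m (fps_X ^ (p - 1))
        = weighted_moment b n (fps_const (fact (p - 1)) * (1 - fps_const (c (p - 1)) * fps_X ^ (p - 1)))] (mod int p)"
      unfolding m_eq weighted_moment_add_index
      by (intro weighted_moment_cong funpow_weighted_deriv_prime_cong b c0 p)
    also have "(1 - fps_const (c (p - 1)) * fps_X ^ (p - 1))
        = fps_const 1 + fps_const (- c (p - 1)) * fps_X ^ (p - 1)" by (simp flip: fps_const_neg)
    also have "weighted_moment b n (fps_const (fact (p - 1)) * \<dots>)
        = fact (p - 1) * (weighted_moment b n (fps_const 1) + - c (p - 1) * ?M)"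
      by (simp only: weighted_moment_const_mult weighted_moment_add)
    also have "[\<dots> = (-1) * (weighted_moment b n (fps_const 1) + - 1 * ?M)] (mod int p)"
      by (intro cong_mult cong_add w cong_refl) (use cp in \<open>simp add: cong_minus_minus_iff\<close>)
    finally have *: "[weighted_moment b m (fps_X ^ (p - 1)) = ?M - weighted_moment b n (fps_const 1)] (mod int p)"
      by simp
    show ?thesis
    proof (cases "n = 0")
      case True
      then show ?thesis using * p1 by (simp add: m_eq)
    next
      case False
      then have "weighted_moment b n (fps_const 1) = 0"
        by (intro weighted_moment_const) simp
      with * have "[weighted_moment b m (fps_X ^ (p - 1)) = ?M] (mod int p)" by simp
      also have "[?M = (if (p - 1) dvd m then -1 else 0)] (mod int p)"
        unfolding dvd_iff using less.IH [OF n] False by simp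
      finally show ?thesis .
    qed
  qed
qed

section \<open>The exceptional exponent 3 modulo 12\<close>

text \<open>Modulo the ideal for 12, \<open>D s^3 = 3 s^2 + s^3\<close>,
  \<open>D (3 s^2) = 6 s\<close> and \<open>D (6 s) = 6 + 6 s\<close>. The moments of
  \<open>6 s\<close> and \<open>3 s^2\<close> are eventually 6, so those of \<open>s^3\<close> gain
  6 at each further step and alternate.\<close>

lemma weighted_moment_X_cubed_cong:
  assumes b0: "fps_nth b 0 = 1" and b1: "odd (fps_nth b 1)"
  shows "[weighted_moment b m (fps_X ^ 3) = (if odd m \<and> m \<ge> 3 then 6 else 0)] (mod 12)"
proof -
  \<comment> \<open>As 12 divides \<open>4!\<close>, four coefficients decide membership.\<close>
  have dvd12I: "hurwitz_dvd 12 f"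
    if "12 dvd fps_nth f 0" "12 dvd fps_nth f 1" "12 dvd 2 * fps_nth f 2" "12 dvd 6 * fps_nth f 3" for f
    unfolding hurwitz_dvd_def
  proof
    fix n :: nat
    consider "n = 0" | "n = 1" | "n = 2" | "n = 3" | "n \<ge> 4" by linarith
    then show "12 dvd fact n * fps_nth f n"
    proof cases
      case 5
      have "(12::int) dvd fact 4" by (simp add: fact_numeral)
      also have "(fact 4::int) dvd fact n" using 5 by (rule fact_dvd)
      finally show ?thesis by simp
    qed (use that in \<open>simp_all add: fact_numeral\<close>)
  qed
  have D3: "hurwitz_cong 12 (weighted_deriv b (fps_X ^ 3)) (fps_const 3 * fps_X ^ 2 + fps_X ^ 3)"
  proof -
    have "weighted_deriv b (fps_X ^ 3) = fps_const 3 * (fps_X ^ 2 * b)"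
      unfolding weighted_deriv_def fps_deriv_power by (simp add: mult_ac)
    \<comment> \<open>The coefficient at index 3, weighted by \<open>3! = 6\<close>: only the parity
      of \<open>fps_nth b 1\<close> counts.\<close>
    moreover have "12 dvd 6 * (3 * fps_nth b 1 - 1)" using b1 by presburger
    ultimately show ?thesis
      unfolding hurwitz_cong_def using b0
      by (intro dvd12I) (simp_all add: fps_X_power_mult_nth)
  qed
  have D2: "hurwitz_cong 12 (weighted_deriv b (fps_const 3 * fps_X ^ 2)) (fps_const 6 * fps_X)"
  proof -
    have "weighted_deriv b (fps_const 3 * fps_X ^ 2) = fps_const 6 * (fps_X ^ 1 * b)"
      unfolding weighted_deriv_const_mult unfolding weighted_deriv_def fps_deriv_power
      by (simp add: mult_ac flip: mult.assoc)
    then show ?thesis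
      unfolding hurwitz_cong_def using b0
      by (intro dvd12I) (simp_all add: fps_X_power_mult_nth del: power_one_right)
  qed
  have D1: "hurwitz_cong 12 (weighted_deriv b (fps_const 6 * fps_X)) (fps_const 6 + fps_const 6 * fps_X)"
  proof -
    have "12 dvd 6 * fps_nth b 1 - 6" using b1 by presburger
    then show ?thesis
      unfolding hurwitz_cong_def weighted_deriv_const_mult using b0
      by (intro dvd12I) (simp_all add: weighted_deriv_def)
  qed
  have M1: "[weighted_moment b m (fps_const 6 * fps_X) = (if m \<ge> 1 then 6 else 0)] (mod 12)" for m
  proof (induction m)
    case (Suc m)
    have "[weighted_moment b (Suc m) (fps_const 6 * fps_X)
        = weighted_moment b m (fps_const 6) + weighted_moment b m (fps_const 6 * fps_X)] (mod 12)"
      unfolding weighted_moment_Suc weighted_moment_add [symmetric]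
      by (rule weighted_moment_cong [OF D1])
    also have "[weighted_moment b m (fps_const 6) + weighted_moment b m (fps_const 6 * fps_X)
        = weighted_moment b m (fps_const 6) + (if m \<ge> 1 then 6 else 0)] (mod 12)"
      by (intro cong_add cong_refl Suc.IH)
    finally show ?case by (cases "m = 0") (simp_all add: weighted_moment_const)
  qed simp
  have M2: "[weighted_moment b m (fps_const 3 * fps_X ^ 2) = (if m \<ge> 2 then 6 else 0)] (mod 12)" for m
  proof (cases m)
    case (Suc l)
    show ?thesis
      unfolding Suc weighted_moment_Suc
      using cong_trans [OF weighted_moment_cong [OF D2] M1 [of l]] by simp
  qed simp
  show ?thesis
  proof (induction m)
    case (Suc m)
    have "[weighted_moment b (Suc m) (fps_X ^ 3)
        = weighted_moment b m (fps_const 3 * fps_X ^ 2) + weighted_moment b m (fps_X ^ 3)] (mod 12)"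
      unfolding weighted_moment_Suc weighted_moment_add [symmetric]
      by (rule weighted_moment_cong [OF D3])
    also have "[weighted_moment b m (fps_const 3 * fps_X ^ 2) + weighted_moment b m (fps_X ^ 3)
        = (if m \<ge> 2 then 6 else 0) + (if odd m \<and> m \<ge> 3 then 6 else 0)] (mod 12)"
      by (intro cong_add M2 Suc.IH)
    also have "[(if m \<ge> 2 then 6 else 0) + (if odd m \<and> m \<ge> 3 then 6 else (0::int))
        = (if odd (Suc m) \<and> Suc m \<ge> 3 then 6 else 0)] (mod 12)"
      by (cases "m = 2") (auto simp: cong_def)
    finally show ?case .
  qed simp
qed

subsection \<open>Denominators of the Bernoulli numbers of a formal group\<close>

text \<open>The ideals live over the integers, while \<open>formal_group_exp c\<close> is a rational
  series; this embedding links the two.\<close>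

definition rat_fps :: "int fps \<Rightarrow> rat fps" where
  "rat_fps f = Abs_fps (\<lambda>n. of_int (fps_nth f n))"

lemma rat_fps_nth [simp]: "fps_nth (rat_fps f) n = of_int (fps_nth f n)"
  by (simp add: rat_fps_def)

lemma rat_fps_mult: "rat_fps (f * g) = rat_fps f * rat_fps g"
  by (rule fps_ext) (simp add: fps_mult_nth)

lemma rat_fps_deriv: "rat_fps (fps_deriv f) = fps_deriv (rat_fps f)"
  by (rule fps_ext) simp

lemma rat_fps_1 [simp]: "rat_fps 1 = 1"
  by (rule fps_ext) simp

lemma rat_fps_X_power: "rat_fps (fps_X ^ i) = fps_X ^ i"
  by (rule fps_ext) simp

lemma formal_group_exp_nth_0 [simp]: "fps_nth (formal_group_exp c) 0 = 0"
  by (simp add: formal_group_exp_def fps_inv_def)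

text \<open>Differentiating \<open>F(G(t)) = t\<close> gives \<open>F'(G) G' = 1\<close>, and
  substitution gives \<open>F'(G) b(G) = 1\<close>.\<close>

lemma fps_deriv_formal_group_exp:
  assumes c0: "c 0 = 1" and b: "Abs_fps c * b = 1"
  shows "fps_deriv (formal_group_exp c) = rat_fps b oo formal_group_exp c"
proof -
  let ?G = "formal_group_exp c"
  have "fps_deriv (formal_group_log c) = rat_fps (Abs_fps c)"
    by (rule fps_ext) (simp add: formal_group_log_def del: of_nat_Suc)
  then have "(rat_fps (Abs_fps c) oo ?G) * fps_deriv ?G = 1"
    using arg_cong [OF formal_group_log_compose_exp [of c, OF c0], of fps_deriv]
    by (simp add: fps_compose_deriv)
  moreover have "(rat_fps (Abs_fps c) oo ?G) * (rat_fps b oo ?G) = 1"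
    by (simp flip: fps_compose_mult_distrib rat_fps_mult add: b)
  ultimately show ?thesis
    by (metis mult.commute mult.left_commute mult.right_neutral)
qed

text \<open>By the chain rule and \<open>G' = b(G)\<close>, differentiating \<open>f(G(t))\<close>
  in \<open>t\<close> amounts to applying the derivation to \<open>f\<close> before
  substituting.\<close>

lemma fact_mult_compose_formal_group_exp_nth:
  assumes c0: "c 0 = 1" and b: "Abs_fps c * b = 1"
  shows "fact n * fps_nth (rat_fps f oo formal_group_exp c) n = of_int (weighted_moment b n f)"
proof (induction n arbitrary: f)
  case (Suc n)
  let ?G = "formal_group_exp c"
  have "fps_deriv (rat_fps f oo ?G) = rat_fps (weighted_deriv b f) oo ?G"
    by (simp add: fps_compose_deriv fps_deriv_formal_group_exp [of c, OF c0 b] weighted_deriv_def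
        rat_fps_mult rat_fps_deriv fps_compose_mult_distrib)
  moreover have "fact (Suc n) * fps_nth (rat_fps f oo ?G) (Suc n)
      = fact n * fps_nth (fps_deriv (rat_fps f oo ?G)) n"
    by (simp add: algebra_simps)
  ultimately show ?case by (simp add: Suc.IH weighted_moment_Suc)
qed simp

text \<open>Put \<open>s = G(t)\<close> in \<open>F(s) = s H(s)\<close> and cancel
  \<open>G(t)\<close>.\<close>

lemma fps_X_div_formal_group_exp_eq_compose:
  assumes c0: "c 0 = 1"
  shows "fps_X / formal_group_exp c
    = Abs_fps (\<lambda>i. of_int (c i) / of_nat (Suc i)) oo formal_group_exp c" (is "_ = ?H oo ?G")
proof -
  have "formal_group_log c = ?H * fps_X"
    by (rule fps_ext) (simp add: formal_group_log_def del: of_nat_Suc)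
  then have "(?H oo ?G) * ?G = fps_X"
    using formal_group_log_compose_exp [of c, OF c0] by (simp add: fps_compose_mult_distrib)
  moreover from this have "?G \<noteq> 0" by auto
  ultimately show ?thesis
    using fps_X_div_formal_group_exp [of c, OF c0] by (metis mult_right_cancel)
qed

text \<open>A formula for the Bernoulli number of index \<open>m\<close>, obtained by expanding the
  composition in powers of \<open>G\<close>; powers beyond \<open>m\<close> do not reach
  \<open>t^m\<close>.\<close>

lemma fact_mult_fps_X_div_formal_group_exp_nth:
  assumes c0: "c 0 = 1" and b: "Abs_fps c * b = 1"
  shows "fact m * fps_nth (fps_X / formal_group_exp c) m
    = (\<Sum>i\<le>m. of_int (c i * weighted_moment b m (fps_X ^ i)) / of_nat (Suc i))"
proof -
  have "fact m * fps_nth (formal_group_exp c ^ i) m = of_int (weighted_moment b m (fps_X ^ i))" for i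
    using fact_mult_compose_formal_group_exp_nth [of c, OF c0 b, of m "fps_X ^ i"]
    by (simp add: rat_fps_X_power flip: fps_compose_power)
  then show ?thesis
    unfolding fps_X_div_formal_group_exp_eq_compose [of c, OF c0] fps_compose_nth sum_distrib_left
    by (intro sum.cong) (auto simp del: of_nat_Suc simp: mult.left_commute)
qed

section \<open>Values of the Bernoulli polynomials at \<open>h / k\<close>\<close>

lemma poly_bernoulli_poly_eq_sum:
  "poly (bernoulli_poly G n) x
    = (\<Sum>m\<le>n. of_nat (n choose m) * x ^ (n - m) * (fact m * fps_nth (fps_X / G) m))"
proof -
  have "poly (bernoulli_poly G n) x = fact n * fps_nth (fps_X / G * fps_exp x) n"
    by (simp flip: bernoulli_poly_gen_fun)
  also have "\<dots> = (\<Sum>m\<le>n. of_nat (n choose m) * x ^ (n - m) * (fact m * fps_nth (fps_X / G) m))"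
    unfolding fps_mult_nth sum_distrib_left atLeast0AtMost
    by (intro sum.cong) (simp_all add: binomial_fact)
  finally show ?thesis .
qed

text \<open>Subtracting the value at 0 removes exactly the term \<open>m = n\<close>.\<close>

lemma power_mult_poly_bernoulli_poly_tilde:
  fixes h k :: rat
  assumes "k \<noteq> 0"
  shows "k ^ n * poly (bernoulli_poly_tilde G n) (h / k)
    = (\<Sum>m<n. of_nat (n choose m) * h ^ (n - m) * k ^ m * (fact m * fps_nth (fps_X / G) m))"
proof -
  let ?B = "\<lambda>m. fact m * fps_nth (fps_X / G) m"
  have split: "poly (bernoulli_poly G n) x
      = (\<Sum>m<n. of_nat (n choose m) * x ^ (n - m) * ?B m) + ?B n" for x
    by (simp add: poly_bernoulli_poly_eq_sum flip: lessThan_Suc_atMost)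
  have "bernoulli_num G n = ?B n"
    unfolding bernoulli_num_def split by (simp add: power_0_left)
  then have "k ^ n * poly (bernoulli_poly_tilde G n) (h / k)
      = k ^ n * (\<Sum>m<n. of_nat (n choose m) * (h / k) ^ (n - m) * ?B m)"
    by (simp add: bernoulli_poly_tilde_def split)
  also have "\<dots> = (\<Sum>m<n. of_nat (n choose m) * h ^ (n - m) * k ^ m * ?B m)"
    unfolding sum_distrib_left
  proof (rule sum.cong)
    fix m assume "m \<in> {..<n}"
    then have "k ^ n = k ^ m * k ^ (n - m)" by (simp flip: power_add)
    then show "k ^ n * (of_nat (n choose m) * (h / k) ^ (n - m) * ?B m)
        = of_nat (n choose m) * h ^ (n - m) * k ^ m * ?B m"
      using assms by (simp add: power_divide)
  qed simp
  finally show ?thesis .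
qed

section \<open>Integrality term by term\<close>

text \<open>If \<open>h\<close> or \<open>k\<close> is even, so is each term, as
  \<open>0 < m < n\<close>. If both are odd, compare with the binomials over all odd
  \<open>m\<close>, whose sum \<open>2 ^ (n - 1)\<close> is even for \<open>n >= 3\<close>: left out
  are \<open>n\<close> at \<open>m = 1\<close> and, for odd \<open>n\<close>, 1 at
  \<open>m = n\<close>, an even total either way.\<close>

lemma even_sum_binomial_odd_ge_3:
  fixes h k :: int
  shows "even (\<Sum>m\<in>{m. m < n \<and> odd m \<and> 3 \<le> m}. int (n choose m) * h ^ (n - m) * k ^ m)"
    (is "even (sum ?w ?A)")
proof (cases "even h \<or> even k \<or> n < 3")
  case True
  then show ?thesis by (auto intro!: dvd_sum)
next
  case False
  then have hk: "odd h" "odd k" and n: "n \<ge> 3" by auto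
  have "even (sum ?w ?A) \<longleftrightarrow> even (\<Sum>m\<in>?A. int (n choose m))"
  proof -
    have "[sum ?w ?A = (\<Sum>m\<in>?A. int (n choose m))] (mod 2)"
    proof (rule cong_sum)
      fix m
      have "[h ^ (n - m) * k ^ m = 1] (mod 2)" using hk by (simp add: cong_def mod_2_eq_odd)
      then have "[int (n choose m) * (h ^ (n - m) * k ^ m) = int (n choose m) * 1] (mod 2)"
        by (rule cong_scalar_left)
      then show "[?w m = int (n choose m)] (mod 2)" by (simp add: mult.assoc)
    qed
    then show ?thesis by (rule cong_dvd_iff)
  qed
  moreover have "even (\<Sum>m\<in>?A. int (n choose m))"
  proof -
    let ?O = "{m. m \<le> n \<and> odd m}"
    have "2 * (\<Sum>m\<le>n. if odd m then int (n choose m) else 0) = 2 ^ n"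
      using choose_odd_sum [of n, where ?'a = int] n by simp
    also have "(\<Sum>m\<le>n. if odd m then int (n choose m) else 0) = (\<Sum>m\<in>?O. int (n choose m))"
      by (simp flip: sum.inter_filter)
    finally have "(\<Sum>m\<in>?O. int (n choose m)) = 2 ^ (n - 1)"
      using n by (cases n) auto
    then have even_O: "even (\<Sum>m\<in>?O. int (n choose m))" using n by simp
    show ?thesis
    proof (cases "odd n")
      case True
      have "m = 1 \<or> 3 \<le> m" if "odd m" for m :: nat using that by presburger
      then have "?O = insert 1 (insert n ?A)" using True n by auto
      then have "(\<Sum>m\<in>?O. int (n choose m)) = int n + (1 + (\<Sum>m\<in>?A. int (n choose m)))"
        using n by simp
      then show ?thesis using even_O True by simp
    next
      case False
      have "m = 1 \<or> 3 \<le> m" if "odd m" for m :: nat using that by presburger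
      moreover have "m < n" if "odd m" "m \<le> n" for m using that False by (metis le_neq_implies_less)
      ultimately have "?O = insert 1 ?A" using n by auto
      then have "(\<Sum>m\<in>?O. int (n choose m)) = int n + (\<Sum>m\<in>?A. int (n choose m))"
        by simp
      then show ?thesis using even_O False by simp
    qed
  qed
  ultimately show ?thesis by simp
qed

text \<open>Since \<open>fact i\<close> divides every moment, non-prime \<open>Suc i\<close> other
  than 4 are immediate. For a prime the moments reduce to 0 or -1, leaving a binomial sum divisible
  by it; \<open>i = 3\<close> rests on the parity of \<open>c 3\<close> or on the moments modulo
  12.\<close>

lemma Suc_dvd_sum_binomial_weighted_moment:
  fixes c :: "nat \<Rightarrow> int" and h k :: int
  assumes c0: "c 0 = 1" and b: "Abs_fps c * b = 1"
    and odd_primes: "\<And>p :: nat. prime p \<Longrightarrow> odd p \<Longrightarrow>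
           [c (p - 1) = 0] (mod int p) \<or> [c (p - 1) = 1] (mod int p)"
    and two: "[c 1 = c 3] (mod 2) \<or> (odd (c 1) \<and> even (c 3))"
  shows "int (Suc i) dvd
    c i * (\<Sum>m<n. int (n choose m) * h ^ (n - m) * k ^ m * weighted_moment b m (fps_X ^ i))"
    (is "_ dvd c i * (\<Sum>m<n. ?w m * ?M m)")
proof -
  have fact_dvd_S: "fact i dvd (\<Sum>m<n. ?w m * ?M m)"
    by (intro dvd_sum dvd_mult dvd_weighted_moment hurwitz_dvd_X_power)
  consider "prime (Suc i)" | "i = 3" | "\<not> prime (Suc i)" "Suc i \<noteq> 4" by linarith
  then show ?thesis
  proof cases
    case 1
    have "[c i = 0] (mod int (Suc i)) \<or> [c i = 1] (mod int (Suc i))"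
    proof (cases "odd (Suc i)")
      \<comment> \<open>For the prime 2 one of the two congruences always holds.\<close>
      case False
      then have "Suc i = 2" using prime_odd_nat [OF 1] prime_ge_2_nat [OF 1] by linarith
      then show ?thesis by (auto simp: cong_def mod_2_eq_odd)
    qed (use odd_primes [of "Suc i"] 1 in auto)
    then show ?thesis
    proof
      assume "[c i = 0] (mod int (Suc i))"
      then show ?thesis by (simp add: cong_0_iff)
    next
      assume ci: "[c i = 1] (mod int (Suc i))"
      let ?A = "{m. 0 < m \<and> m < n \<and> (Suc i - 1) dvd m}"
      have i: "i > 0" using 1 by (cases i) auto
      \<comment> \<open>At \<open>m = 0\<close> the moment is the constant term of
        \<open>fps_X ^ i\<close>, which is 0 and not -1; hence the condition
        \<open>0 < m\<close>.\<close>
      have M: "[?w m * ?M m = (if 0 < m \<and> i dvd m then - ?w m else 0)] (mod int (Suc i))" for m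
      proof (cases "m = 0")
        case False
        then have "[?M m = (if i dvd m then -1 else 0)] (mod int (Suc i))"
          using weighted_moment_X_power_prime_cong [of c b "Suc i" m] b c0 1 ci by simp
        then have "[?w m * ?M m = ?w m * (if i dvd m then -1 else 0)] (mod int (Suc i))"
          by (rule cong_scalar_left)
        then show ?thesis using False by (simp split: if_splits)
      qed (use i in simp)
      have S: "[(\<Sum>m<n. ?w m * ?M m) = (\<Sum>m<n. if 0 < m \<and> i dvd m then - ?w m else 0)] (mod int (Suc i))"
        by (rule cong_sum) (rule M)
      moreover have "(\<Sum>m<n. if 0 < m \<and> i dvd m then - ?w m else 0) = - sum ?w ?A"
      proof -
        have "(\<Sum>m<n. if 0 < m \<and> i dvd m then - ?w m else 0)
            = (\<Sum>m\<in>{m \<in> {..<n}. 0 < m \<and> i dvd m}. - ?w m)"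
          by (rule sum.inter_filter [symmetric]) simp
        also have "\<dots> = - sum ?w ?A"
          unfolding sum_negf by (intro arg_cong [of _ _ uminus] sum.cong) auto
        finally show ?thesis .
      qed
      moreover have "int (Suc i) dvd sum ?w ?A"
        by (rule prime_dvd_sum_binomial_multiples [OF 1])
      ultimately have "int (Suc i) dvd (\<Sum>m<n. ?w m * ?M m)"
        by (simp only: cong_dvd_iff [OF S] dvd_minus_iff)
      then show ?thesis by (rule dvd_mult)
    qed
  next
    case 2
    show ?thesis
    proof (cases "even (c 3)")
      case True
      have "(6::int) dvd (\<Sum>m<n. ?w m * ?M m)"
        using fact_dvd_S 2 by (simp add: fact_numeral)
      \<comment> \<open>The even \<open>c 3\<close> supplies the factor 2 that \<open>3! = 6\<close>
        lacks for divisibility by 4.\<close>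
      then have "2 * 6 dvd c 3 * (\<Sum>m<n. ?w m * ?M m)"
        using True by (intro mult_dvd_mono)
      then have "4 dvd c 3 * (\<Sum>m<n. ?w m * ?M m)"
        by (rule dvd_trans [rotated]) simp
      then show ?thesis using 2 by simp
    next
      case False
      \<comment> \<open>With \<open>c 3\<close> odd, only the alternative
        \<open>[c 1 = c 3] (mod 2)\<close> remains.\<close>
      then have "odd (c 1)" using two by (auto simp: cong_def mod_2_eq_odd split: if_splits)
      have b0: "fps_nth b 0 = 1"
        using arg_cong [OF b, of "\<lambda>f. fps_nth f 0"] c0 by simp
      have "fps_nth b 1 = - c 1"
        using arg_cong [OF b, of "\<lambda>f. fps_nth f 1"] c0 b0 by (simp add: fps_mult_nth)
      then have b1: "odd (fps_nth b 1)" using \<open>odd (c 1)\<close> by simp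
      let ?A = "{m. m < n \<and> odd m \<and> 3 \<le> m}"
      have "[(\<Sum>m<n. ?w m * ?M m) = (\<Sum>m<n. ?w m * (if odd m \<and> 3 \<le> m then 6 else 0))] (mod 12)"
        unfolding 2
        by (intro cong_sum cong_scalar_left weighted_moment_X_cubed_cong b0 b1)
      moreover have "(\<Sum>m<n. ?w m * (if odd m \<and> 3 \<le> m then 6 else 0)) = sum ?w ?A * 6"
      proof -
        have "(\<Sum>m<n. ?w m * (if odd m \<and> 3 \<le> m then 6 else 0))
            = (\<Sum>m<n. if odd m \<and> 3 \<le> m then ?w m * 6 else 0)"
          by (rule sum.cong) simp_all
        also have "\<dots> = (\<Sum>m\<in>{m \<in> {..<n}. odd m \<and> 3 \<le> m}. ?w m * 6)"
          by (rule sum.inter_filter [symmetric]) simp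
        also have "\<dots> = sum ?w ?A * 6"
          unfolding sum_distrib_right by (intro sum.cong) auto
        finally show ?thesis .
      qed
      \<comment> \<open>The evenness of the binomial sum supplies the missing factor 2.\<close>
      moreover have "2 * 6 dvd sum ?w ?A * 6"
        by (intro mult_dvd_mono even_sum_binomial_odd_ge_3) simp
      ultimately have "12 dvd (\<Sum>m<n. ?w m * ?M m)"
        by (simp add: cong_dvd_iff)
      then have "4 dvd (\<Sum>m<n. ?w m * ?M m)"
        by (rule dvd_trans [rotated]) simp
      then show ?thesis using 2 by simp
    qed
  next
    case 3
    then have "Suc i dvd fact i" using composite_dvd_fact_pred [of "Suc i"] by simp
    then have "int (Suc i) dvd fact i" by (metis of_nat_dvd_iff of_nat_fact)
    then show ?thesis using fact_dvd_S by (meson dvd_mult dvd_trans)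
  qed
qed

theorem theorem1:
  fixes c :: "nat \<Rightarrow> int" and h k :: int and n :: nat
  assumes "c 0 = 1"
    and "\<And>p :: nat. prime p \<Longrightarrow> odd p \<Longrightarrow>
           [c (p - 1) = 0] (mod int p) \<or> [c (p - 1) = 1] (mod int p)"
    and "[c 1 = c 3] (mod 2) \<or> (odd (c 1) \<and> even (c 3))"
    and "h > 0" and "k > 0"
  shows "of_int k ^ n *
           poly (bernoulli_poly_tilde (formal_group_exp c) n) (of_int h / of_int k) \<in> \<int>"
proof -
  \<comment> \<open>The inverse \<open>1 / F'\<close> is integral because \<open>F'\<close> has
    constant term \<open>c 0 = 1\<close>.\<close>
  define b where "b = fps_right_inverse (Abs_fps c) 1"
  have b: "Abs_fps c * b = 1"
    unfolding b_def by (rule fps_right_inverse) (simp add: assms(1))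
  let ?w = "\<lambda>m. int (n choose m) * h ^ (n - m) * k ^ m"
  let ?M = "\<lambda>m i. weighted_moment b m (fps_X ^ i)"
  have "of_int k ^ n * poly (bernoulli_poly_tilde (formal_group_exp c) n) (of_int h / of_int k)
      = (\<Sum>m<n. of_int (?w m) * (\<Sum>i\<le>m. of_int (c i * ?M m i) / (of_nat (Suc i) :: rat)))"
    using assms(5)
    by (simp add: power_mult_poly_bernoulli_poly_tilde
        fact_mult_fps_X_div_formal_group_exp_nth [of c, OF assms(1) b] del: of_nat_Suc)
  \<comment> \<open>The added moments with \<open>i > m\<close> vanish; the inner range becomes
    independent of \<open>m\<close>, so the sums can be swapped and each \<open>i\<close> treated
    alone.\<close>
  also have "\<dots> = (\<Sum>m<n. of_int (?w m) * (\<Sum>i<n. of_int (c i * ?M m i) / of_nat (Suc i)))"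
  proof (rule sum.cong [OF refl])
    fix m assume "m \<in> {..<n}"
    then have "(\<Sum>i\<le>m. of_int (c i * ?M m i) / (of_nat (Suc i) :: rat))
        = (\<Sum>i<n. of_int (c i * ?M m i) / of_nat (Suc i))"
      using weighted_moment_X_power_eq_0 [of m _ b 1]
      by (intro sum.mono_neutral_left) auto
    then show "of_int (?w m) * (\<Sum>i\<le>m. of_int (c i * ?M m i) / (of_nat (Suc i) :: rat))
        = of_int (?w m) * (\<Sum>i<n. of_int (c i * ?M m i) / of_nat (Suc i))"
      by (rule arg_cong)
  qed
  also have "\<dots> = (\<Sum>i<n. of_int (c i * (\<Sum>m<n. ?w m * ?M m i)) / of_nat (Suc i))"
    unfolding sum_distrib_left
    by (subst sum.swap) (simp add: sum_divide_distrib sum_distrib_left mult_ac del: of_nat_Suc)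
  also have "\<dots> \<in> \<int>"
  proof (rule Ints_sum)
    fix i
    have "int (Suc i) dvd c i * (\<Sum>m<n. ?w m * ?M m i)"
      by (rule Suc_dvd_sum_binomial_weighted_moment [of c, OF assms(1) b assms(2,3)])
    then obtain z where z: "c i * (\<Sum>m<n. ?w m * ?M m i) = int (Suc i) * z" by (rule dvdE)
    show "of_int (c i * (\<Sum>m<n. ?w m * ?M m i)) / (of_nat (Suc i) :: rat) \<in> \<int>"
      unfolding z by (simp del: of_nat_Suc)
  qed
  finally show ?thesis .
qed

end
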